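(* The mappings $\mathfrak{G}:\mathrm{QSS}\to\mathrm{QSO}\setminus\{\langle\varnothing,\varnothing\rangle\}$ and $\mathfrak{I}:\mathrm{QSO}\setminus\{\langle\varnothing,\varnothing\rangle\}\to\mathrm{QSS}$ are inverse bijections.
   Context: QS-orders. $\mathrm{QSO}$ is the smallest set of pairs $\langle\Delta,\prec\rangle$ such that $\langle\varnothing,\varnothing\rangle\in\mathrm{QSO}$ and, for all $q=\langle\Delta,\prec\rangle$, $q'=\langle\Delta',\prec'\rangle$ in $\mathrm{QSO}$: (i) if $x\notin\Delta$, then $q[x]=\langle\Delta\cup\{x\},\prec\rangle\in\mathrm{QSO}$; (ii) if $\Delta\cap\Delta'=\varnothing$, then $q\circ q'=\langle\Delta\cup\Delta',\prec\cup\prec'\cup(\Delta\times\Delta')\rangle\in\mathrm{QSO}$. The operation $\circ$ is associative. An element $q\in\mathrm{QSO}$ is a qso-stratum if $q=q'[x]$ for some $q'\in\mathrm{QSO}$ and $x$. Every $q\in\mathrm{QSO}$ different from $\langle\varnothing,\varnothing\rangle$ has a unique decomposition $q=q_1\circ\dots\circ q_n$ ($n\geq1$) into qso-strata. QS-sequences. $\mathrm{QSS}$ (qs-sequences) and $\mathrm{QSSS}$ (qss-strata) are the smallest sets of formal expressions, with domains $\delta$, such that: (a) every finite nonempty set $\Delta$ belongs to $\mathrm{QSS}\cap\mathrm{QSSS}$, with $\delta_\Delta=\Delta$; (b) for $n\geq2$ and qss-strata $s_1,\dots,s_n$ with mutually disjoint domains, the sequence $s_1\dots s_n$ belongs to $\mathrm{QSS}$,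 with $\delta_{s_1\dots s_n}=\delta_{s_1}\cup\dots\cup\delta_{s_n}$; (c) for $n\geq2$, a finite nonempty set $\Delta$ and qss-strata $s_1,\dots,s_n$ with mutually disjoint domains satisfying $\Delta\cap\delta_{s_1\dots s_n}=\varnothing$, the pair $\langle\Delta,s_1\dots s_n\rangle$ belongs to $\mathrm{QSS}\cap\mathrm{QSSS}$, with domain $\Delta\cup\delta_{s_1\dots s_n}$. The mapping $\mathfrak{G}$: $\mathfrak{G}(\Delta)=\langle\Delta,\varnothing\rangle$; $\mathfrak{G}(s_1\dots s_n)=\mathfrak{G}(s_1)\circ\dots\circ\mathfrak{G}(s_n)$; $\mathfrak{G}(\langle\{x_1,\dots,x_k\},s_1\dots s_n\rangle)=\mathfrak{G}(s_1\dots s_n)[x_1]\dots[x_k]$. The mapping $\mathfrak{I}$, for $q\in\mathrm{QSO}\setminus\{\langle\varnothing,\varnothing\rangle\}$: if $q$ is a qso-stratum, write $q=q'[x_1]\dots[x_n]$ ($n\geq1$), where $x_1,\dots,x_n$ are all the elements of the domain of $q$ which are unrelated by $\prec_q$ to every element of the domain, and $q'\in\mathrm{QSO}$; then $\mathfrak{I}(q)=\{x_1,\dots,x_n\}$ if $q'=\langle\varnothing,\varnothing\rangle$, and $\mathfrak{I}(q)=\langle\{x_1,\dots,x_n\},\mathfrak{I}(q')\rangle$ otherwise. If $q$ is not a qso-stratum, let $q=q_1\circ\dots\circ q_n$ ($n\geq2$) be its decomposition into qso-strata; then $\mathfrak{I}(q)=\mathfrak{I}(q_1)\dots\mathfrak{I}(q_n)$.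 *)

theory Defs
  imports Main
begin

section \<open>QS-orders\<close>

type_synonym 'a qso = "'a set \<times> ('a \<times> 'a) set"

definition qso_add :: "'a qso \<Rightarrow> 'a \<Rightarrow> 'a qso" where
  "qso_add q x = (fst q \<union> {x}, snd q)"

definition qso_comp :: "'a qso \<Rightarrow> 'a qso \<Rightarrow> 'a qso" where
  "qso_comp q q' = (fst q \<union> fst q', snd q \<union> snd q' \<union> (fst q \<times> fst q'))"

inductive_set QSO :: "'a qso set" where
  empty: "({}, {}) \<in> QSO"
| add: "q \<in> QSO \<Longrightarrow> x \<notin> fst q \<Longrightarrow> qso_add q x \<in> QSO"
| comp: "q \<in> QSO \<Longrightarrow> q' \<in> QSO \<Longrightarrow> fst q \<inter> fst q' = {} \<Longrightarrow> qso_comp q q' \<in> QSO"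

definition qso_stratum :: "'a qso \<Rightarrow> bool" where
  "qso_stratum q \<longleftrightarrow> (\<exists>q'\<in>QSO. \<exists>x. x \<notin> fst q' \<and> q = qso_add q' x)"

text \<open>The pair \<open>({}, {})\<close> is neutral for \<^const>\<open>qso_comp\<close>, so closing the fold with it
  does not change the composition of a nonempty list.\<close>

definition qso_comp_list :: "'a qso list \<Rightarrow> 'a qso" where
  "qso_comp_list qs = foldr qso_comp qs ({}, {})"

definition qso_decomposition :: "'a qso \<Rightarrow> 'a qso list \<Rightarrow> bool" where
  "qso_decomposition q qs \<longleftrightarrow>
     qs \<noteq> [] \<and> (\<forall>p\<in>set qs. qso_stratum p) \<and>
     sorted_wrt (\<lambda>p p'. fst p \<inter> fst p' = {}) qs \<and> q = qso_comp_list qs"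

text \<open>Iterated addition \<open>q[x\<^sub>1]\<dots>[x\<^sub>k]\<close>, which depends only on the set of
  the added elements; see \<open>foldl_qso_add\<close>.\<close>

definition qso_add_set :: "'a qso \<Rightarrow> 'a set \<Rightarrow> 'a qso" where
  "qso_add_set q X = (fst q \<union> X, snd q)"

definition qso_isolated :: "'a qso \<Rightarrow> 'a set" where
  "qso_isolated q = {x \<in> fst q. \<forall>y\<in>fst q. (x, y) \<notin> snd q \<and> (y, x) \<notin> snd q}"

text \<open>The part \<open>q'\<close> of \<open>q = q'[x\<^sub>1]\<dots>[x\<^sub>n]\<close> when
  \<open>x\<^sub>1, \<dots>, x\<^sub>n\<close> are all the isolated elements; see \<open>qso_core_iff\<close>.\<close>

definition qso_core :: "'a qso \<Rightarrow> 'a qso" where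
  "qso_core q = (fst q - qso_isolated q, snd q)"

text \<open>Well-defined on \<open>QSO - {({}, {})}\<close> by \<open>qso_decomposition_ex1\<close>.\<close>

definition qso_strata :: "'a qso \<Rightarrow> 'a qso list" where
  "qso_strata q = (THE qs. qso_decomposition q qs)"

lemma foldl_qso_add: "foldl qso_add q xs = qso_add_set q (set xs)"
  by (induction xs arbitrary: q) (auto simp: qso_add_def qso_add_set_def)

lemma QSO_finite: "q \<in> QSO \<Longrightarrow> finite (fst q)"
  by (induction rule: QSO.induct) (auto simp: qso_add_def qso_comp_def)

lemma QSO_field: "q \<in> QSO \<Longrightarrow> snd q \<subseteq> fst q \<times> fst q"
  by (induction rule: QSO.induct) (auto simp: qso_add_def qso_comp_def)

lemma qso_stratum_QSO: "qso_stratum q \<Longrightarrow> q \<in> QSO"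
  by (auto simp: qso_stratum_def intro: QSO.add)

lemma qso_isolated_stratum:
  assumes "qso_stratum q"
  shows "qso_isolated q \<noteq> {}"
proof -
  obtain q' x where q': "q' \<in> QSO" "x \<notin> fst q'" "q = qso_add q' x"
    using assms by (auto simp: qso_stratum_def)
  then have "x \<in> qso_isolated q"
    using QSO_field[OF q'(1)] by (auto simp: qso_isolated_def qso_add_def)
  then show ?thesis by auto
qed

lemma qso_comp_empty [simp]: "qso_comp ({}, {}) q = q" "qso_comp q ({}, {}) = q"
  by (simp_all add: qso_comp_def)

lemma qso_comp_assoc: "qso_comp (qso_comp p q) r = qso_comp p (qso_comp q r)"
  by (auto simp: qso_comp_def)

lemma QSO_eq_empty: "q \<in> QSO \<Longrightarrow> fst q = {} \<longleftrightarrow> q = ({}, {})"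
  using QSO_field[of q] by (cases q) auto

lemma qso_core_QSO: "q \<in> QSO \<Longrightarrow> qso_core q \<in> QSO"
proof (induction rule: QSO.induct)
  case empty
  then show ?case by (simp add: qso_core_def QSO.empty)
next
  case (add q x)
  have "qso_isolated (qso_add q x) = insert x (qso_isolated q)"
    using QSO_field[OF add(1)] add(2) by (auto simp: qso_isolated_def qso_add_def)
  then have "qso_core (qso_add q x) = qso_core q"
    using add(2) by (auto simp: qso_core_def qso_add_def)
  then show ?case using add by simp
next
  case (comp q q')
  show ?case
  proof (cases "fst q = {} \<or> fst q' = {}")
    case True
    then show ?thesis
      using comp QSO_eq_empty[of q] QSO_eq_empty[of q'] by auto
  next
    case False
    then have "qso_isolated (qso_comp q q') = {}"
      by (auto simp: qso_isolated_def qso_comp_def)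
    then have "qso_core (qso_comp q q') = qso_comp q q'"
      by (simp add: qso_core_def)
    then show ?thesis using comp by (simp add: QSO.comp)
  qed
qed

lemma qso_core_iff:
  assumes "q \<in> QSO"
  shows "q' \<in> QSO \<and> fst q' \<inter> qso_isolated q = {} \<and> q = qso_add_set q' (qso_isolated q)
    \<longleftrightarrow> q' = qso_core q"
proof
  assume h: "q' \<in> QSO \<and> fst q' \<inter> qso_isolated q = {} \<and> q = qso_add_set q' (qso_isolated q)"
  then have "fst q = fst q' \<union> qso_isolated q" "snd q = snd q'"
    by (metis qso_add_set_def fst_conv, metis qso_add_set_def snd_conv)
  with h show "q' = qso_core q"
    by (auto simp: qso_core_def prod_eq_iff)
next
  assume "q' = qso_core q"
  moreover have "qso_isolated q \<subseteq> fst q"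
    by (auto simp: qso_isolated_def)
  ultimately show "q' \<in> QSO \<and> fst q' \<inter> qso_isolated q = {} \<and> q = qso_add_set q' (qso_isolated q)"
    using qso_core_QSO[OF assms]
    by (simp add: qso_core_def qso_add_set_def Un_absorb2 Int_commute)
qed

lemma qso_comp_list_simps [simp]:
  "qso_comp_list [] = ({}, {})"
  "qso_comp_list (q # qs) = qso_comp q (qso_comp_list qs)"
  by (simp_all add: qso_comp_list_def)

lemma qso_comp_list_append:
  "qso_comp_list (qs @ qs') = qso_comp (qso_comp_list qs) (qso_comp_list qs')"
  by (induction qs) (simp_all add: qso_comp_assoc)

lemma fst_qso_comp_list: "fst (qso_comp_list qs) = (\<Union>p\<in>set qs. fst p)"
  by (induction qs) (auto simp: qso_comp_def)

lemma qso_comp_list_QSO: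
  assumes "\<forall>p\<in>set qs. p \<in> QSO" "sorted_wrt (\<lambda>p p'. fst p \<inter> fst p' = {}) qs"
  shows "qso_comp_list qs \<in> QSO"
  using assms
proof (induction qs)
  case (Cons q qs)
  then have "fst q \<inter> fst (qso_comp_list qs) = {}"
    by (simp add: fst_qso_comp_list Int_UN_distrib)
  then show ?case
    using Cons by (simp add: QSO.comp)
qed (simp add: QSO.empty)

lemma qso_decomposition_ex:
  "q \<in> QSO \<Longrightarrow> q \<noteq> ({}, {}) \<Longrightarrow> \<exists>qs. qso_decomposition q qs"
proof (induction rule: QSO.induct)
  case (add q x)
  then have "qso_decomposition (qso_add q x) [qso_add q x]"
    by (auto simp: qso_decomposition_def qso_stratum_def)
  then show ?case by blast
next
  case (comp q q')
  show ?case
  proof (cases "q = ({}, {}) \<or> q' = ({}, {})")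
    case True
    then show ?thesis using comp by auto
  next
    case False
    then obtain qs qs' where d: "qso_decomposition q qs" "qso_decomposition q' qs'"
      using comp by auto
    have "\<forall>p\<in>set qs. \<forall>p'\<in>set qs'. fst p \<inter> fst p' = {}"
      using comp(3) d by (auto simp: qso_decomposition_def fst_qso_comp_list)
    with d have "qso_decomposition (qso_comp q q') (qs @ qs')"
      by (auto simp: qso_decomposition_def sorted_wrt_append qso_comp_list_append)
    then show ?thesis by blast
  qed
qed simp

lemma qso_comp_dom_subset:
  assumes x1: "x1 \<in> D1" "\<And>y. (x1, y) \<notin> R1 \<and> (y, x1) \<notin> R1" and x2: "x2 \<in> D2"
    and S1: "S1 \<subseteq> E1 \<times> E1" and d: "D1 \<inter> E1 = {}"
    and D: "D1 \<union> E1 = D2 \<union> E2" and R: "R1 \<union> S1 \<union> D1 \<times> E1 = R2 \<union> S2 \<union> D2 \<times> E2"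
  shows "D1 \<subseteq> D2"
proof -
  have lt: "(a, b) \<in> R1 \<or> (a, b) \<in> E1 \<times> E1 \<or> (a, b) \<in> D1 \<times> E1"
    if "a \<in> D2" "b \<in> E2" for a b
  proof -
    have "(a, b) \<in> R1 \<union> S1 \<union> D1 \<times> E1" unfolding R using that by simp
    then show ?thesis using S1 by auto
  qed
  have "x1 \<notin> E1" using x1(1) d by auto
  then have "x1 \<notin> E2" using lt[OF x2, of x1] x1(2) by auto
  then have "x1 \<in> D2" using x1(1) D by auto
  then have "y \<notin> E2" if "y \<in> D1" for y
    using lt[of x1 y] that x1 d by auto
  then show ?thesis using D by auto
qed

lemma qso_comp_stratum_cancel:
  assumes s: "qso_stratum p" "qso_stratum p'" and r: "r \<in> QSO" "r' \<in> QSO"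
    and d: "fst p \<inter> fst r = {}" "fst p' \<inter> fst r' = {}"
    and eq: "qso_comp p r = qso_comp p' r'"
  shows "p = p' \<and> r = r'"
proof -
  note F = QSO_field[OF qso_stratum_QSO[OF s(1)]] QSO_field[OF qso_stratum_QSO[OF s(2)]]
    QSO_field[OF r(1)] QSO_field[OF r(2)]
  have iso: "\<exists>x. x \<in> fst p \<and> (\<forall>y. (x, y) \<notin> snd p \<and> (y, x) \<notin> snd p)"
    if "qso_stratum p" for p :: "'a qso"
    using qso_isolated_stratum[OF that] QSO_field[OF qso_stratum_QSO[OF that]]
    unfolding qso_isolated_def by blast
  obtain x where x: "x \<in> fst p" "\<And>y. (x, y) \<notin> snd p \<and> (y, x) \<notin> snd p"
    using iso[OF s(1)] by blast
  obtain x' where x': "x' \<in> fst p'" "\<And>y. (x', y) \<notin> snd p' \<and> (y, x') \<notin> snd p'"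
    using iso[OF s(2)] by blast
  have D: "fst p \<union> fst r = fst p' \<union> fst r'"
    and R: "snd p \<union> snd r \<union> fst p \<times> fst r = snd p' \<union> snd r' \<union> fst p' \<times> fst r'"
    using eq unfolding qso_comp_def by (blast dest: Pair_inject)+
  have P: "fst p = fst p'"
    using qso_comp_dom_subset[OF x x'(1) F(3) d(1) D R]
      qso_comp_dom_subset[OF x' x(1) F(4) d(2) D[symmetric] R[symmetric]] by (rule equalityI)
  have Q: "fst r = fst r'"
    using D d P by auto
  have restr: "R = (R \<union> S \<union> A \<times> B) \<inter> (A \<times> A) \<and> S = (R \<union> S \<union> A \<times> B) \<inter> (B \<times> B)"
    if "R \<subseteq> A \<times> A" "S \<subseteq> B \<times> B" "A \<inter> B = {}" for R S :: "('a \<times> 'a) set" and A B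
    using that by auto
  have "snd p = snd p'" "snd r = snd r'"
    using restr[OF F(1,3) d(1)] restr[OF F(2,4) d(2)] R unfolding P Q by argo+
  with P Q show ?thesis by (simp add: prod_eq_iff)
qed

lemma qso_decomposition_unique:
  assumes "qso_decomposition q qs" "qso_decomposition q qs'"
  shows "qs = qs'"
proof -
  have ne: "fst p \<noteq> {}" if "qso_stratum p" for p :: "'a qso"
    using that by (auto simp: qso_stratum_def qso_add_def)
  have "qs = qs'"
    if "\<forall>p\<in>set qs. qso_stratum p" "\<forall>p\<in>set qs'. qso_stratum p"
      "sorted_wrt (\<lambda>p p'. fst p \<inter> fst p' = {}) qs"
      "sorted_wrt (\<lambda>p p'. fst p \<inter> fst p' = {}) qs'"
      "qso_comp_list qs = qso_comp_list qs'"
    for qs qs' :: "'a qso list"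
    using that
  proof (induction qs arbitrary: qs')
    case Nil
    have "fst (qso_comp_list qs') = {}"
      using Nil(5) by (metis fst_conv qso_comp_list_simps(1))
    then have "\<forall>p\<in>set qs'. fst p = {}"
      by (simp add: fst_qso_comp_list)
    then show ?case
      using ne[of "hd qs'"] Nil(2) by (cases qs') simp_all
  next
    case (Cons p qs)
    show ?case
    proof (cases qs')
      case Nil
      then have "fst (qso_comp_list (p # qs)) = {}"
        using Cons.prems(5) by simp
      then have "fst p = {}"
        by (simp add: qso_comp_def)
      then show ?thesis
        using ne[of p] Cons.prems(1) by simp
    next
      case (Cons p' qs'')
      have "fst p \<inter> fst (qso_comp_list qs) = {}" "fst p' \<inter> fst (qso_comp_list qs'') = {}"
        using Cons.prems(3,4) Cons by (simp_all add: fst_qso_comp_list Int_UN_distrib)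
      moreover have "qso_comp_list qs \<in> QSO" "qso_comp_list qs'' \<in> QSO"
        using Cons.prems(1-4) Cons by (simp_all add: qso_comp_list_QSO qso_stratum_QSO)
      ultimately have "p = p' \<and> qso_comp_list qs = qso_comp_list qs''"
        using Cons.prems(1,2,5) Cons by (intro qso_comp_stratum_cancel) simp_all
      then show ?thesis
        using Cons.IH[of qs''] Cons.prems Cons by simp
    qed
  qed
  then show ?thesis
    using assms by (simp add: qso_decomposition_def)
qed

lemma qso_decomposition_ex1:
  "q \<in> QSO \<Longrightarrow> q \<noteq> ({}, {}) \<Longrightarrow> \<exists>!qs. qso_decomposition q qs"
  using qso_decomposition_ex qso_decomposition_unique by blast

lemma qso_strata_decomposition:
  "q \<in> QSO \<Longrightarrow> q \<noteq> ({}, {}) \<Longrightarrow> qso_decomposition q (qso_strata q)"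
  unfolding qso_strata_def by (rule theI'[OF qso_decomposition_ex1])

lemma qso_decomposition_card_less:
  assumes "qso_decomposition q qs" "\<not> qso_stratum q" "p \<in> set qs"
  shows "card (fst p) < card (fst q)"
proof -
  obtain ys zs where qs: "qs = ys @ p # zs"
    using assms(3) by (meson split_list)
  have st: "\<forall>p\<in>set qs. qso_stratum p"
    and so: "sorted_wrt (\<lambda>p p'. fst p \<inter> fst p' = {}) qs"
    and q: "q = qso_comp_list qs"
    using assms(1) by (auto simp: qso_decomposition_def)
  have "ys @ zs \<noteq> []"
    using assms(2) st q qs by auto
  then obtain p' where p': "p' \<in> set (ys @ zs)"
    by (meson last_in_set)
  then have "fst p' \<inter> fst p = {}"
    using so qs by (auto simp: sorted_wrt_append)
  moreover have "qso_stratum p'"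
    using st p' qs by auto
  then have "fst p' \<noteq> {}"
    by (auto simp: qso_stratum_def qso_add_def)
  moreover have "fst p' \<subseteq> fst q" "fst p \<subseteq> fst q"
    using p' qs q by (auto simp: fst_qso_comp_list)
  ultimately have "fst p \<subset> fst q" by blast
  moreover have "finite (fst q)"
    using st so q qso_comp_list_QSO qso_stratum_QSO QSO_finite by blast
  ultimately show ?thesis by (simp add: psubset_card_mono)
qed


section \<open>QS-sequences\<close>

text \<open>Raw formal expressions: a set, a sequence of expressions, and a pair of a set and
  an expression. The well-formed ones are singled out by \<open>QSS\<close> and \<open>QSSS\<close>.\<close>

datatype 'a qs_expr =
    QSet "'a set"
  | QSeq "'a qs_expr list"
  | QPair "'a set" "'a qs_expr"

primrec qs_dom :: "'a qs_expr \<Rightarrow> 'a set" where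
  "qs_dom (QSet D) = D"
| "qs_dom (QSeq ss) = \<Union> (set (map qs_dom ss))"
| "qs_dom (QPair D s) = D \<union> qs_dom s"

inductive_set QSS :: "'a qs_expr set" and QSSS :: "'a qs_expr set" where
  QSS_set: "finite D \<Longrightarrow> D \<noteq> {} \<Longrightarrow> QSet D \<in> QSS"
| QSSS_set: "finite D \<Longrightarrow> D \<noteq> {} \<Longrightarrow> QSet D \<in> QSSS"
| QSS_seq: "length ss \<ge> 2 \<Longrightarrow> \<forall>s\<in>set ss. s \<in> QSSS \<Longrightarrow>
    sorted_wrt (\<lambda>s s'. qs_dom s \<inter> qs_dom s' = {}) ss \<Longrightarrow> QSeq ss \<in> QSS"
| QSS_pair: "finite D \<Longrightarrow> D \<noteq> {} \<Longrightarrow> length ss \<ge> 2 \<Longrightarrow> \<forall>s\<in>set ss. s \<in> QSSS \<Longrightarrow>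
    sorted_wrt (\<lambda>s s'. qs_dom s \<inter> qs_dom s' = {}) ss \<Longrightarrow>
    D \<inter> qs_dom (QSeq ss) = {} \<Longrightarrow> QPair D (QSeq ss) \<in> QSS"
| QSSS_pair: "finite D \<Longrightarrow> D \<noteq> {} \<Longrightarrow> length ss \<ge> 2 \<Longrightarrow> \<forall>s\<in>set ss. s \<in> QSSS \<Longrightarrow>
    sorted_wrt (\<lambda>s s'. qs_dom s \<inter> qs_dom s' = {}) ss \<Longrightarrow>
    D \<inter> qs_dom (QSeq ss) = {} \<Longrightarrow> QPair D (QSeq ss) \<in> QSSS"


section \<open>The mappings\<close>

primrec qs_G :: "'a qs_expr \<Rightarrow> 'a qso" where
  "qs_G (QSet D) = (D, {})"
| "qs_G (QSeq ss) = qso_comp_list (map qs_G ss)"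
| "qs_G (QPair D s) = qso_add_set (qs_G s) D"

text \<open>The value outside \<open>QSO - {({}, {})}\<close> is irrelevant. In the last case the list
  \<^term>\<open>qso_strata q\<close> has at least two elements, since \<^term>\<open>q\<close> is not a stratum.\<close>

function qs_I :: "'a qso \<Rightarrow> 'a qs_expr" where
  "qs_I q =
    (if q \<notin> QSO \<or> q = ({}, {}) then undefined
     else if qso_stratum q then
       (if qso_core q = ({}, {}) then QSet (qso_isolated q)
        else QPair (qso_isolated q) (qs_I (qso_core q)))
     else QSeq (map qs_I (qso_strata q)))"
  by pat_completeness auto
termination
proof (relation "measure (\<lambda>q. card (fst q))")
  fix q :: "'a qso"
  assume q: "\<not> (q \<notin> QSO \<or> q = ({}, {}))" and "qso_stratum q"
  then have "fst (qso_core q) \<subset> fst q"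
    using qso_isolated_stratum[of q] by (auto simp: qso_core_def qso_isolated_def)
  then show "(qso_core q, q) \<in> measure (\<lambda>q. card (fst q))"
    using q QSO_finite[of q] by (simp add: psubset_card_mono)
next
  fix q p :: "'a qso"
  assume "\<not> (q \<notin> QSO \<or> q = ({}, {}))" "\<not> qso_stratum q" "p \<in> set (qso_strata q)"
  then show "(p, q) \<in> measure (\<lambda>q. card (fst q))"
    using qso_decomposition_card_less[OF qso_strata_decomposition, of q p] by simp
qed simp

declare qs_I.simps [simp del]

end

(* A qso-order with at least two strata has no isolated element, since any two strata are
   completely related by the order. So a nonempty qso-order is a stratum iff it has an isolated
   element, and stripping the isolated elements of a stratum leaves an order without any. Hence
   in G(<D, s_1 ... s_n>) the set of isolated elements is exactly D, and the decomposition of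
   G(s_1 ... s_n) into strata is G(s_1), ..., G(s_n): both steps of I recover what G assembled. *)
theory Submission
  imports Defs
begin

section \<open>Isolated elements, strata and set-wise addition\<close>

lemma qso_stratum_nonempty: "qso_stratum q \<Longrightarrow> fst q \<noteq> {}"
  by (auto simp: qso_stratum_def qso_add_def)

lemma qso_isolated_comp:
  assumes "fst p \<noteq> {}" "fst q \<noteq> {}"
  shows "qso_isolated (qso_comp p q) = {}"
  using assms by (auto simp: qso_isolated_def qso_comp_def)

text \<open>Split off the first stratum: both it and the rest are nonempty, and their composition
  relates each element of one to each element of the other.\<close>

lemma qso_isolated_decomposition:
  assumes "qso_decomposition q qs" "length qs \<ge> 2"
  shows "qso_isolated q = {}"
proof -
  obtain p p' ps where qs: "qs = p # p' # ps"
    using assms(2) by (metis Suc_le_length_iff numeral_2_eq_2)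
  then have "q = qso_comp p (qso_comp_list (p' # ps))" "fst p \<noteq> {}" "fst p' \<noteq> {}"
    using assms(1) by (auto simp: qso_decomposition_def dest: qso_stratum_nonempty)
  moreover from this have "fst (qso_comp_list (p' # ps)) \<noteq> {}"
    by (simp add: qso_comp_def)
  ultimately show ?thesis
    by (metis qso_isolated_comp)
qed

text \<open>If \<open>[p]\<close> were the decomposition, then \<open>q = p\<close> would be a
  stratum.\<close>

lemma qso_decomposition_length:
  assumes "qso_decomposition q qs" "\<not> qso_stratum q"
  shows "length qs \<ge> 2"
proof (rule ccontr)
  assume "\<not> length qs \<ge> 2"
  then obtain p where "qs = [p]"
    using assms(1) by (cases qs; cases "tl qs") (auto simp: qso_decomposition_def)
  then show False
    using assms by (simp add: qso_decomposition_def)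
qed

lemma qso_strata_eq: "qso_decomposition q qs \<Longrightarrow> qso_strata q = qs"
  unfolding qso_strata_def by (blast intro: the_equality qso_decomposition_unique)

lemma qso_add_set_QSO:
  assumes "finite D" "q \<in> QSO" "D \<inter> fst q = {}"
  shows "qso_add_set q D \<in> QSO"
  using assms
proof (induction D)
  case empty
  then show ?case by (simp add: qso_add_set_def)
next
  case (insert x D)
  have "qso_add_set q (insert x D) = qso_add (qso_add_set q D) x"
    by (simp add: qso_add_set_def qso_add_def)
  moreover have "x \<notin> fst (qso_add_set q D)"
    using insert by (simp add: qso_add_set_def)
  ultimately show ?case
    using insert by (simp add: QSO.add)
qed

text \<open>Any element of \<open>D\<close> can be taken as the one added last.\<close>

lemma qso_stratum_add_set:
  assumes "finite D" "D \<noteq> {}" "q \<in> QSO" "D \<inter> fst q = {}"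
  shows "qso_stratum (qso_add_set q D)"
proof -
  obtain x where x: "x \<in> D" using assms(2) by blast
  have "qso_add_set q (D - {x}) \<in> QSO"
    using assms by (intro qso_add_set_QSO) auto
  moreover have "x \<notin> fst (qso_add_set q (D - {x}))"
    using x assms(4) by (auto simp: qso_add_set_def)
  moreover have "qso_add_set q D = qso_add (qso_add_set q (D - {x})) x"
    using x by (auto simp: qso_add_set_def qso_add_def)
  ultimately show ?thesis
    unfolding qso_stratum_def by blast
qed

text \<open>The relation of \<open>q\<close> lives on \<open>fst q\<close>, so it cannot involve the
  new elements, and adding them leaves it unchanged.\<close>

lemma qso_isolated_add_set:
  assumes "q \<in> QSO" "D \<inter> fst q = {}"
  shows "qso_isolated (qso_add_set q D) = D \<union> qso_isolated q"
  using assms(2) QSO_field[OF assms(1)] by (auto simp: qso_isolated_def qso_add_set_def)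

text \<open>If \<open>x\<close> is not isolated in \<open>q\<close>, an element related to
  \<open>x\<close> is not isolated either, so it survives in the core together with
  \<open>x\<close>.\<close>

lemma qso_isolated_core:
  assumes "q \<in> QSO"
  shows "qso_isolated (qso_core q) = {}"
  using QSO_field[OF assms] by (auto simp: qso_isolated_def qso_core_def)

text \<open>Since \<open>q\<close> has no isolated elements of its own, taking the core strips
  exactly \<open>D\<close>.\<close>

lemma qso_core_add_set:
  assumes "q \<in> QSO" "D \<inter> fst q = {}" "qso_isolated q = {}"
  shows "qso_core (qso_add_set q D) = q"
  using qso_isolated_add_set[OF assms(1,2)] assms(2,3)
  by (auto simp: qso_core_def qso_add_set_def prod_eq_iff)

lemma qso_add_set_isolated_core: "q \<in> QSO \<Longrightarrow> qso_add_set (qso_core q) (qso_isolated q) = q"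
  using qso_core_iff by metis

section \<open>Domains, decompositions and the recursion of \<open>qs_I\<close>\<close>

lemma fst_qs_G: "fst (qs_G s) = qs_dom s"
  by (induction s) (auto simp: fst_qso_comp_list qso_add_set_def)

lemma sorted_wrt_disjoint_qs_G:
  "sorted_wrt (\<lambda>p p'. fst p \<inter> fst p' = {}) (map qs_G ss) \<longleftrightarrow>
   sorted_wrt (\<lambda>s s'. qs_dom s \<inter> qs_dom s' = {}) ss"
  by (simp add: sorted_wrt_map fst_qs_G)

lemma qs_G_QSeq_decomposition:
  assumes "ss \<noteq> []" "\<forall>s\<in>set ss. qso_stratum (qs_G s)"
    "sorted_wrt (\<lambda>s s'. qs_dom s \<inter> qs_dom s' = {}) ss"
  shows "qso_decomposition (qs_G (QSeq ss)) (map qs_G ss)"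
  using assms by (simp add: qso_decomposition_def sorted_wrt_disjoint_qs_G)

lemma qso_decomposition_QSO: "qso_decomposition q qs \<Longrightarrow> q \<in> QSO"
  by (auto simp: qso_decomposition_def intro: qso_comp_list_QSO qso_stratum_QSO)

text \<open>Evaluates the stratum branch of \<open>qs_I\<close>: the isolated elements are
  \<open>D\<close> and the core is \<open>q\<close>. The two outcomes match the expressions
  \<open>QSet\<close> and \<open>QPair\<close>.\<close>

lemma qs_I_add_set:
  assumes "finite D" "D \<noteq> {}" "q \<in> QSO" "D \<inter> fst q = {}" "qso_isolated q = {}"
  shows "qs_I (qso_add_set q D) = (if q = ({}, {}) then QSet D else QPair D (qs_I q))"
proof -
  have "qso_stratum (qso_add_set q D)"
    using assms by (intro qso_stratum_add_set)
  moreover from this have "qso_add_set q D \<in> QSO" "qso_add_set q D \<noteq> ({}, {})"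
    using qso_stratum_QSO qso_stratum_nonempty by fastforce+
  ultimately show ?thesis
    using assms qso_core_add_set[of q D] qso_isolated_add_set[of q D]
    by (auto simp: qs_I.simps[of "qso_add_set q D"])
qed

text \<open>Evaluates the other branch of \<open>qs_I\<close>: \<open>q\<close> has no isolated
  element, hence is no stratum, and by uniqueness any decomposition at hand is
  \<open>qso_strata q\<close>.\<close>

lemma qs_I_decomposition:
  assumes "qso_decomposition q qs" "length qs \<ge> 2"
  shows "qs_I q = QSeq (map qs_I qs)"
proof -
  have "q \<in> QSO"
    using assms(1) by (rule qso_decomposition_QSO)
  moreover have "\<not> qso_stratum q"
    using qso_isolated_decomposition[OF assms] qso_isolated_stratum by blast
  moreover have "hd qs \<in> set qs" "qso_stratum (hd qs)"
    using assms by (auto simp: qso_decomposition_def)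
  then have "fst q \<noteq> {}"
    using assms(1) qso_stratum_nonempty[of "hd qs"]
    by (auto simp: qso_decomposition_def fst_qso_comp_list)
  ultimately show ?thesis
    using qso_strata_eq[OF assms(1)] by (auto simp: qs_I.simps[of q])
qed

section \<open>\<open>qs_I\<close> undoes \<open>qs_G\<close>\<close>

text \<open>Makes a plain set the case of \<open>qs_I_add_set\<close> with the empty order as
  core.\<close>

lemma qs_G_QSet: "qs_G (QSet D) = qso_add_set ({}, {}) D"
  by (simp add: qso_add_set_def)

lemma qs_I_qs_G_QSet:
  assumes "finite D" "D \<noteq> {}"
  shows "qso_stratum (qs_G (QSet D)) \<and> qs_I (qs_G (QSet D)) = QSet D"
  unfolding qs_G_QSet using assms
  by (simp add: qso_stratum_add_set qs_I_add_set QSO.empty qso_isolated_def)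

lemma qs_I_qs_G_QSeq:
  assumes "length ss \<ge> 2" "\<forall>s\<in>set ss. qso_stratum (qs_G s) \<and> qs_I (qs_G s) = s"
    "sorted_wrt (\<lambda>s s'. qs_dom s \<inter> qs_dom s' = {}) ss"
  shows "qs_G (QSeq ss) \<in> QSO" "qs_G (QSeq ss) \<noteq> ({}, {})"
    "qso_isolated (qs_G (QSeq ss)) = {}" "qs_I (qs_G (QSeq ss)) = QSeq ss"
proof -
  have d: "qso_decomposition (qs_G (QSeq ss)) (map qs_G ss)"
    using assms by (intro qs_G_QSeq_decomposition) auto
  have l: "length (map qs_G ss) \<ge> 2" using assms(1) by simp
  show "qs_G (QSeq ss) \<in> QSO" using d by (rule qso_decomposition_QSO)
  have "hd ss \<in> set ss" using assms(1) by (cases ss) auto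
  moreover from this have "qs_dom (hd ss) \<noteq> {}"
    using assms(2) qso_stratum_nonempty[of "qs_G (hd ss)"] by (simp add: fst_qs_G)
  ultimately have "fst (qs_G (QSeq ss)) \<noteq> {}"
    unfolding fst_qs_G by auto
  then show "qs_G (QSeq ss) \<noteq> ({}, {})" by auto
  show "qso_isolated (qs_G (QSeq ss)) = {}"
    using d l by (rule qso_isolated_decomposition)
  show "qs_I (qs_G (QSeq ss)) = QSeq ss"
    using qs_I_decomposition[OF d l] assms(2) by (simp add: map_idI)
qed

lemma qs_I_qs_G_QPair:
  assumes "finite D" "D \<noteq> {}" "length ss \<ge> 2"
    "\<forall>s\<in>set ss. qso_stratum (qs_G s) \<and> qs_I (qs_G s) = s"
    "sorted_wrt (\<lambda>s s'. qs_dom s \<inter> qs_dom s' = {}) ss" "D \<inter> qs_dom (QSeq ss) = {}"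
  shows "qso_stratum (qs_G (QPair D (QSeq ss))) \<and>
    qs_I (qs_G (QPair D (QSeq ss))) = QPair D (QSeq ss)"
proof -
  note * = qs_I_qs_G_QSeq[OF assms(3-5)]
  have "D \<inter> fst (qs_G (QSeq ss)) = {}"
    using assms(6) by (simp only: fst_qs_G)
  with * assms(1,2) show ?thesis
    \<comment> \<open>\<open>qs_G (QSeq ss)\<close> must stay folded for the facts about it to
      apply.\<close>
    by (simp add: qso_stratum_add_set qs_I_add_set del: qs_G.simps(2))
qed

text \<open>Simultaneous induction on both classes. For qss-strata the claim is strengthened to
  \<open>qso_stratum\<close>, so that the images of the terms of a sequence form its
  decomposition.\<close>

lemma qs_I_qs_G_aux:
  fixes s t :: "'a qs_expr"
  shows "(s \<in> QSS \<longrightarrow> qs_G s \<in> QSO - {({}, {})} \<and> qs_I (qs_G s) = s) \<and>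
    (t \<in> QSSS \<longrightarrow> qso_stratum (qs_G t) \<and> qs_I (qs_G t) = t)"
proof -
  have stratum: "q \<in> QSO - {({}, {})}" if "qso_stratum q" for q :: "'a qso"
    using qso_stratum_QSO[OF that] qso_stratum_nonempty[OF that] by auto
  show ?thesis
  proof (induction rule: QSS_QSSS.induct)
    case (QSS_set D)
    then show ?case using qs_I_qs_G_QSet stratum by blast
  next
    case (QSSS_set D)
    then show ?case by (rule qs_I_qs_G_QSet)
  next
    case (QSS_seq ss)
    then show ?case using qs_I_qs_G_QSeq[of ss] by blast
  next
    case (QSS_pair D ss)
    then show ?case using qs_I_qs_G_QPair[of D ss] stratum by blast
  next
    case (QSSS_pair D ss)
    then show ?case using qs_I_qs_G_QPair[of D ss] by blast
  qed
qed

lemma qs_G_QSO: "s \<in> QSS \<Longrightarrow> qs_G s \<in> QSO - {({}, {})}"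
  and qs_I_qs_G: "s \<in> QSS \<Longrightarrow> qs_I (qs_G s) = s"
  using qs_I_qs_G_aux[of s s] by simp_all

section \<open>\<open>qs_G\<close> undoes \<open>qs_I\<close>\<close>

text \<open>Recovers the conditions on \<open>ss\<close> that the rules for pairs ask for.\<close>

inductive_cases QSeq_QSS: "QSeq ss \<in> QSS"

text \<open>Induction along the recursion of \<open>qs_I\<close>. Membership in \<open>QSSS\<close>
  for strata is carried along because the terms of a sequence must be qss-strata.\<close>

lemma qs_I_QSS_qs_G_qs_I:
  "q \<in> QSO \<Longrightarrow> q \<noteq> ({}, {}) \<Longrightarrow>
    qs_I q \<in> QSS \<and> (qso_stratum q \<longrightarrow> qs_I q \<in> QSSS) \<and> qs_G (qs_I q) = q"
proof (induction q rule: qs_I.induct)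
  case (1 q)
  note q = \<open>q \<in> QSO\<close> \<open>q \<noteq> ({}, {})\<close>
  show ?case
  proof (cases "qso_stratum q")
    case True
    let ?D = "qso_isolated q" and ?c = "qso_core q"
    have D: "finite ?D" "?D \<noteq> {}"
      using QSO_finite[OF q(1)] qso_isolated_stratum[OF True] by (simp_all add: qso_isolated_def)
    have add: "qso_add_set ?c ?D = q"
      using q(1) by (rule qso_add_set_isolated_core)
    have c: "?c \<in> QSO"
      using q(1) by (rule qso_core_QSO)
    show ?thesis
    proof (cases "?c = ({}, {})")
      case empty: True
      then have "qs_I q = QSet ?D"
        using q True by (simp add: qs_I.simps[of q])
      then show ?thesis
        using D add empty by (simp add: QSS_set QSSS_set qso_add_set_def)
    next
      case False
      have IH: "qs_I ?c \<in> QSS" "qs_G (qs_I ?c) = ?c"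
        using 1(1) q True False c by blast+
      \<comment> \<open>The core has no isolated elements, so \<open>qs_I\<close> sends it to a
        sequence, the only second component allowed in a pair.\<close>
      have "\<not> qso_stratum ?c"
        using qso_isolated_core[OF q(1)] qso_isolated_stratum by blast
      then obtain ss where ss: "qs_I ?c = QSeq ss"
        using c False by (simp add: qs_I.simps[of ?c])
      have I: "qs_I q = QPair ?D (QSeq ss)"
        using q True False ss by (simp add: qs_I.simps[of q])
      have "qs_dom (QSeq ss) = fst ?c"
        using IH(2) ss fst_qs_G by metis
      then have disj: "?D \<inter> qs_dom (QSeq ss) = {}"
        by (auto simp: qso_core_def)
      have "QSeq ss \<in> QSS"
        using IH(1) ss by simp
      then have "QPair ?D (QSeq ss) \<in> QSS \<inter> QSSS"
        by (rule QSeq_QSS) (use D disj in \<open>simp add: QSS_pair QSSS_pair\<close>)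
      moreover have "qs_G (QPair ?D (QSeq ss)) = q"
        using IH(2) ss add by simp
      ultimately show ?thesis
        unfolding I by blast
    qed
  next
    case False
    let ?qs = "qso_strata q"
    have d: "qso_decomposition q ?qs"
      using q by (rule qso_strata_decomposition)
    have l: "length ?qs \<ge> 2"
      using d False by (rule qso_decomposition_length)
    have I: "qs_I q = QSeq (map qs_I ?qs)"
      using d l by (rule qs_I_decomposition)
    have IH: "qs_I p \<in> QSSS \<and> qs_G (qs_I p) = p" if p: "p \<in> set ?qs" for p
    proof -
      have s: "qso_stratum p"
        using d p by (simp add: qso_decomposition_def)
      then have "p \<in> QSO" "p \<noteq> ({}, {})"
        using qso_stratum_QSO qso_stratum_nonempty by fastforce+
      then show ?thesis
        using 1(2)[OF _ False p] q s by blast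
    qed
    have G: "map qs_G (map qs_I ?qs) = ?qs"
      using IH by (simp add: map_idI)
    \<comment> \<open>As \<open>qs_G\<close> preserves domains and maps the terms back to the
      strata, disjointness carries over from the decomposition.\<close>
    have "sorted_wrt (\<lambda>s s'. qs_dom s \<inter> qs_dom s' = {}) (map qs_I ?qs)"
      using d unfolding sorted_wrt_disjoint_qs_G[symmetric] G by (simp add: qso_decomposition_def)
    then have "qs_I q \<in> QSS"
      unfolding I using l IH by (intro QSS_seq) auto
    moreover have "qs_G (qs_I q) = q"
      unfolding I qs_G.simps G using d by (simp add: qso_decomposition_def)
    ultimately show ?thesis
      using False by blast
  qed
qed

theorem theorem4p4:
  "bij_betw qs_G (QSS :: 'a qs_expr set) (QSO - {({}, {})}) \<and>
   bij_betw qs_I (QSO - {({}, {})}) (QSS :: 'a qs_expr set) \<and>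
   (\<forall>s\<in>(QSS :: 'a qs_expr set). qs_I (qs_G s) = s) \<and>
   (\<forall>q\<in>QSO - {({} :: 'a set, {} :: ('a \<times> 'a) set)}. qs_G (qs_I q) = q)"
proof -
  have IG: "\<forall>s\<in>(QSS :: 'a qs_expr set). qs_I (qs_G s) = s"
    by (simp add: qs_I_qs_G)
  have GI: "\<forall>q\<in>QSO - {({} :: 'a set, {} :: ('a \<times> 'a) set)}. qs_G (qs_I q) = q"
    by (simp add: qs_I_QSS_qs_G_qs_I)
  have G: "qs_G ` (QSS :: 'a qs_expr set) \<subseteq> QSO - {({}, {})}"
    by (rule image_subsetI) (rule qs_G_QSO)
  have I: "qs_I ` (QSO - {({}, {})}) \<subseteq> (QSS :: 'a qs_expr set)"
    by (rule image_subsetI) (simp add: qs_I_QSS_qs_G_qs_I)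
  show ?thesis
    by (intro conjI bij_betw_byWitness[OF IG GI G I] bij_betw_byWitness[OF GI IG I G] IG GI)
qed

end
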